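(* Let $G$ be a finite graph with maximum degree $\Delta(G)$, and let $H$ be a finite graph on $n$ vertices. Then \begin{itemize} \item $\mathrm{ch}(G[H]) \le (4\Delta(G)+2)(\mathrm{ch}(H) + \log_2 n)$, and \item $\chi_P(G[H]) \le (4\Delta(G)+2)(\chi_P(H) + \log_2 n)$. \end{itemize}
   Context: All graphs are finite and simple. The lexicographic product $G[H]$ of graphs $G=(V_1,E_1)$ and $H=(V_2,E_2)$ is the graph with vertex set $V_1\times V_2$ in which $(v_1,v_2)$ is adjacent to $(v_1',v_2')$ if and only if either $v_1v_1'\in E_1$, or $v_1=v_1'$ and $v_2v_2'\in E_2$. $\mathrm{ch}(G)$ denotes the choice number: the least $k$ such that for every assignment of lists $L(v)$ of $k$ colors to the vertices, there is a proper coloring giving each vertex a color from its list. The paint number $\chi_P(G)$ is defined via the following game between Lister and Painter, for positive integers $k,b$ (the $b$-fold $k$-painting game): in round $i$, Lister presents a non-empty set $V_i\subseteq V(G)$ such that each $v\in V_i$ is contained in fewer than $b$ of the sets $X_j$, $j\le i-1$; Painter then chooses an independent set $X_i\subseteq V_i$. If at the end of some round some vertex $v$ is contained in $k$ of the sets $V_i$ but in fewer than $b$ of the sets $X_i$, Lister wins; otherwise at some round every vertex is contained in $b$ of the sets $X_i$ and Painter wins. $G$ is $b$-fold $k$-paintable if Painter has a winning strategy; $\chi_{P,b}(G)$ is the least $k$ for which $G$ is $b$-fold $k$-paintable, and $\chi_P(G)=\chi_{P,1}(G)$. $\Delta(G)$ denotes the maximum degree of $G$, and $\log_2$ is the base-2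 logarithm. *)

theory Defs
  imports Complex_Main "Graph_Theory.Pair_Digraph"
begin

text \<open>
  A finite simple graph is a \<open>pair_graph\<close> of the library: a finite vertex set together with a
  symmetric and irreflexive adjacency relation on it. Every edge is thus represented by two
  mutually inverse arcs, so that the degree of a vertex is its out-degree.
\<close>

text \<open>Inserting \<open>0\<close> only matters for the graph without vertices.\<close>

definition max_degree :: "'a pair_pre_digraph \<Rightarrow> nat" where
  "max_degree G = Max (insert 0 (out_degree (with_proj G) ` pverts G))"

definition lex_product ::
    "'a pair_pre_digraph \<Rightarrow> 'b pair_pre_digraph \<Rightarrow> ('a \<times> 'b) pair_pre_digraph" where
  "lex_product G H =
     \<lparr> pverts = pverts G \<times> pverts H,
       parcs = {((u, x), (v, y)) | u x v y.
                  (u, x) \<in> pverts G \<times> pverts H \<and> (v, y) \<in> pverts G \<times> pverts H \<and>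
                  ((u, v) \<in> parcs G \<or> u = v \<and> (x, y) \<in> parcs H)} \<rparr>"

lemma pair_graph_lex_product:
  assumes "pair_graph G" "pair_graph H"
  shows "pair_graph (lex_product G H)"
proof -
  interpret G: pair_graph G by (rule assms(1))
  interpret H: pair_graph H by (rule assms(2))
  have fin: "finite (pverts G \<times> pverts H)" by simp
  have sub: "parcs (lex_product G H) \<subseteq> (pverts G \<times> pverts H) \<times> (pverts G \<times> pverts H)"
    by (auto simp: lex_product_def)
  have irr: "\<And>v. (v, v) \<notin> parcs G" "\<And>v. (v, v) \<notin> parcs H"
    using G.pair_no_loops H.pair_no_loops by fastforce+
  show ?thesis
  proof
    show "finite (pverts (lex_product G H))" using fin by (simp add: lex_product_def)
    show "finite (parcs (lex_product G H))" using fin sub by (meson finite_SigmaI finite_subset)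
    show "symmetric (with_proj (lex_product G H))"
      using G.arcs_symmetric H.arcs_symmetric by (auto simp: symmetric_def sym_def lex_product_def)
  qed (use sub irr in \<open>auto simp: lex_product_def\<close>)
qed

definition independent_in :: "'a pair_pre_digraph \<Rightarrow> 'a set \<Rightarrow> bool" where
  "independent_in G X \<longleftrightarrow> X \<subseteq> pverts G \<and> (\<forall>u\<in>X. \<forall>v\<in>X. (u, v) \<notin> parcs G)"


section \<open>Choice number\<close>

text \<open>
  Colours are natural numbers; this is no restriction, as only finitely many colours occur in a
  list assignment of a finite graph. Finiteness of the lists matters only for \<open>k = 0\<close>, since
  infinite sets have \<open>card\<close> zero.
\<close>

definition list_colorable :: "'a pair_pre_digraph \<Rightarrow> ('a \<Rightarrow> nat set) \<Rightarrow> bool" where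
  "list_colorable G L \<longleftrightarrow>
     (\<exists>c. (\<forall>v\<in>pverts G. c v \<in> L v) \<and> (\<forall>(u, v)\<in>parcs G. c u \<noteq> c v))"

definition choosable :: "'a pair_pre_digraph \<Rightarrow> nat \<Rightarrow> bool" where
  "choosable G k \<longleftrightarrow>
     (\<forall>L. (\<forall>v\<in>pverts G. finite (L v) \<and> card (L v) = k) \<longrightarrow> list_colorable G L)"

definition choice_number :: "'a pair_pre_digraph \<Rightarrow> nat" where
  "choice_number G = (LEAST k. choosable G k)"


section \<open>The painting game\<close>

text \<open>
  A history lists the rounds played so far in chronological order; the round \<open>(P, X)\<close> consists of
  the set \<open>P\<close> presented by Lister and the set \<open>X\<close> chosen by Painter.
\<close>

type_synonym 'a history = "('a set \<times> 'a set) list"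

definition times_presented :: "'a history \<Rightarrow> 'a \<Rightarrow> nat" where
  "times_presented h v = length (filter (\<lambda>(P, X). v \<in> P) h)"

definition times_chosen :: "'a history \<Rightarrow> 'a \<Rightarrow> nat" where
  "times_chosen h v = length (filter (\<lambda>(P, X). v \<in> X) h)"

definition lister_move :: "'a pair_pre_digraph \<Rightarrow> nat \<Rightarrow> 'a history \<Rightarrow> 'a set \<Rightarrow> bool" where
  "lister_move G b h P \<longleftrightarrow> P \<noteq> {} \<and> P \<subseteq> pverts G \<and> (\<forall>v\<in>P. times_chosen h v < b)"

definition painter_move :: "'a pair_pre_digraph \<Rightarrow> 'a set \<Rightarrow> 'a set \<Rightarrow> bool" where
  "painter_move G P X \<longleftrightarrow> X \<subseteq> P \<and> independent_in G X"

definition lister_won :: "'a pair_pre_digraph \<Rightarrow> nat \<Rightarrow> nat \<Rightarrow> 'a history \<Rightarrow> bool" where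
  "lister_won G b k h \<longleftrightarrow> (\<exists>v\<in>pverts G. times_presented h v = k \<and> times_chosen h v < b)"

definition painter_won :: "'a pair_pre_digraph \<Rightarrow> nat \<Rightarrow> 'a history \<Rightarrow> bool" where
  "painter_won G b h \<longleftrightarrow> (\<forall>v\<in>pverts G. times_chosen h v = b)"

text \<open>
  The histories that can arise when Painter follows the strategy \<open>s\<close>, which maps the previous
  rounds and the set just presented to Painter's choice. The game stops as soon as Lister has won;
  once Painter has won, Lister has no legal move.
\<close>

inductive play_with ::
    "'a pair_pre_digraph \<Rightarrow> nat \<Rightarrow> nat \<Rightarrow> ('a history \<Rightarrow> 'a set \<Rightarrow> 'a set) \<Rightarrow> 'a history \<Rightarrow> bool"
  for G b k s where
  start: "play_with G b k s []"
| round: "play_with G b k s h \<Longrightarrow> \<not> lister_won G b k h \<Longrightarrow> lister_move G b h P \<Longrightarrow>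
            play_with G b k s (h @ [(P, s h P)])"

text \<open>
  The strategy must always give a legal answer and never let Lister win. Since the game is finite
  and can only get stuck when Painter has won (lemmas \<open>play_with_length\<close> and
  \<open>stuck_imp_painter_won\<close>), this means that Painter wins every play that follows the strategy.
\<close>

definition painter_winning_strategy ::
    "'a pair_pre_digraph \<Rightarrow> nat \<Rightarrow> nat \<Rightarrow> ('a history \<Rightarrow> 'a set \<Rightarrow> 'a set) \<Rightarrow> bool" where
  "painter_winning_strategy G b k s \<longleftrightarrow>
     (\<forall>h. play_with G b k s h \<longrightarrow>
        \<not> lister_won G b k h \<and> (\<forall>P. lister_move G b h P \<longrightarrow> painter_move G P (s h P)))"

definition paintable :: "'a pair_pre_digraph \<Rightarrow> nat \<Rightarrow> nat \<Rightarrow> bool" where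
  "paintable G b k \<longleftrightarrow> (\<exists>s. painter_winning_strategy G b k s)"

text \<open>The game is only meaningful for positive \<open>k\<close> and \<open>b\<close>.\<close>

definition fold_paint_number :: "nat \<Rightarrow> 'a pair_pre_digraph \<Rightarrow> nat" where
  "fold_paint_number b G = (LEAST k. 0 < k \<and> paintable G b k)"

definition paint_number :: "'a pair_pre_digraph \<Rightarrow> nat" where
  "paint_number G = fold_paint_number 1 G"

lemma play_with_presented_le:
  assumes "play_with G b k s h" "v \<in> pverts G"
  shows "times_presented h v \<le> k"
  using assms
proof induction
  case (round h P)
  then show ?case
    by (fastforce simp: times_presented_def lister_won_def lister_move_def)
qed (simp add: times_presented_def)

lemma play_with_length:
  assumes "play_with G b k s h" "finite (pverts G)"
  shows "length h \<le> k * card (pverts G)"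
proof -
  have "length h \<le> (\<Sum>v\<in>pverts G. times_presented h v)"
    using assms
  proof induction
    case (round h P)
    then have "P \<noteq> {}" "P \<subseteq> pverts G" by (auto simp: lister_move_def)
    with round.prems have "1 \<le> card P"
      by (simp add: Suc_le_eq card_gt_0_iff finite_subset)
    also have "card P = (\<Sum>v\<in>pverts G. if v \<in> P then 1 else 0)"
      using round.prems \<open>P \<subseteq> pverts G\<close> by (simp add: sum.If_cases Int_absorb1)
    finally have "length h + 1 \<le> (\<Sum>v\<in>pverts G. times_presented h v + (if v \<in> P then 1 else 0))"
      using round by (simp add: sum.distrib)
    also have "\<dots> = (\<Sum>v\<in>pverts G. times_presented (h @ [(P, s h P)]) v)"
      by (rule sum.cong) (auto simp: times_presented_def)
    finally show ?case by simp
  qed simp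
  also have "\<dots> \<le> (\<Sum>v\<in>pverts G. k)"
    by (rule sum_mono) (rule play_with_presented_le[OF assms(1)])
  finally show ?thesis by (simp add: mult.commute)
qed

lemma stuck_imp_painter_won:
  assumes "painter_winning_strategy G b k s" "play_with G b k s h" "\<nexists>P. lister_move G b h P"
  shows "painter_won G b h"
proof -
  have "times_chosen h v \<le> b" if "v \<in> pverts G" for v
    using assms(2)
  proof induction
    case (round h P)
    then have "s h P \<subseteq> P"
      using assms(1) by (auto simp: painter_winning_strategy_def painter_move_def)
    with round show ?case
      by (fastforce simp: times_chosen_def lister_move_def)
  qed (simp add: times_chosen_def)
  moreover have "\<not> times_chosen h v < b" if "v \<in> pverts G" for v
    using assms(3) that by (auto simp: lister_move_def dest!: spec[of _ "{v}"])
  ultimately show ?thesis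
    by (auto simp: painter_won_def le_less)
qed

end

theory Submission
  imports Defs
begin

text \<open>
  In every round (one round per colour, or one move of Lister) select an independent set \<open>I\<close> of
  \<open>G\<close>, and let only the copies of \<open>H\<close> at the vertices of \<open>I\<close> use the round; there the list
  colouring, or the winning strategy, of \<open>H\<close> is followed. The set \<open>I\<close> is chosen greedily: give
  \<open>(v, x)\<close> the weight \<open>(1 + \<epsilon>)\<^sup>r / 2\<^sup>a\<close>, where \<open>\<epsilon> = 1 / (4 \<Delta> + 1)\<close> and where
  \<open>a\<close> (\<open>r\<close>) counts the rounds presenting \<open>(v, x)\<close> in which \<open>v\<close> was (was not) selected, and take
  the copies in decreasing order of the weight presented in them. A skipped copy has a selected
  neighbour of at least its weight, so its losses are charged to the gains of its neighbours.
  As the gains of a copy are bounded by its total weight, no copy ever weighs more than \<open>2 n\<close>,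
  whence \<open>r \<le> (4 \<Delta> + 1) (a + 1 + log\<^sub>2 n)\<close>.
\<close>

section \<open>Choosability and paintability of finite graphs\<close>

text \<open>Vertices are coloured one at a time: the colours already used are fewer than the size of
  the next list.\<close>

lemma exists_inj_choice:
  assumes "finite V" "\<And>v. v \<in> V \<Longrightarrow> finite (L v) \<and> card V \<le> card (L v)"
  shows "\<exists>c. (\<forall>v\<in>V. c v \<in> L v) \<and> inj_on c V"
  using assms
proof (induction V)
  case (insert v F)
  then obtain c where c: "\<forall>u\<in>F. c u \<in> L u" "inj_on c F"
    by (metis Suc_leD card_insert_disjoint insertCI)
  have "card (c ` F) < card (L v)"
    using insert card_image_le[of F c] by (metis Suc_le_eq card_insert_disjoint insertI1 le_less_trans)
  then obtain a where "a \<in> L v" "a \<notin> c ` F"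
    using insert.hyps by (metis card_mono finite_imageI leD subsetI)
  with c insert.hyps show ?case
    by (intro exI[of _ "c(v := a)"]) (auto simp: inj_on_def)
qed simp

text \<open>An injective choice is proper. This provides the witness that makes the
  \<open>LEAST\<close> in \<open>choice_number\<close> meaningful.\<close>

lemma choosable_card:
  assumes "pair_graph G"
  shows "choosable G (card (pverts G))"
  unfolding choosable_def
proof (intro allI impI)
  interpret pair_graph G by (rule assms)
  fix L :: "'a \<Rightarrow> nat set"
  assume L: "\<forall>v\<in>pverts G. finite (L v) \<and> card (L v) = card (pverts G)"
  then obtain c where c: "\<forall>v\<in>pverts G. c v \<in> L v" "inj_on c (pverts G)"
    using exists_inj_choice[of "pverts G" L] by auto
  moreover have "c u \<noteq> c v" if "(u, v) \<in> parcs G" for u v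
    using that c(2) pair_no_loops in_arcsD1 in_arcsD2 by (metis fst_conv inj_onD snd_conv)
  ultimately show "list_colorable G L"
    unfolding list_colorable_def by blast
qed

lemma choosable_choice_number:
  assumes "pair_graph G"
  shows "choosable G (choice_number G)"
  unfolding choice_number_def using choosable_card[OF assms] by (rule LeastI)

lemma list_colorable_if_choosable:
  assumes "choosable G k" "\<And>v. v \<in> pverts G \<Longrightarrow> finite (L v) \<and> k \<le> card (L v)"
  shows "list_colorable G L"
proof -
  have "\<forall>v\<in>pverts G. \<exists>M. M \<subseteq> L v \<and> card M = k \<and> finite M"
    using assms(2) by (meson obtain_subset_with_card_n)
  then obtain M where M: "\<forall>v\<in>pverts G. M v \<subseteq> L v \<and> card (M v) = k \<and> finite (M v)"
    by metis
  then have "list_colorable G M"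
    using assms(1) by (simp add: choosable_def)
  with M show ?thesis
    unfolding list_colorable_def by (meson subsetD)
qed

section \<open>Strategies in the painting game\<close>

lemma times_presented_simps [simp]:
  "times_presented [] v = 0"
  "times_presented (h @ [(P, X)]) v = times_presented h v + (if v \<in> P then 1 else 0)"
  by (auto simp: times_presented_def)

lemma times_chosen_simps [simp]:
  "times_chosen [] v = 0"
  "times_chosen (h @ [(P, X)]) v = times_chosen h v + (if v \<in> X then 1 else 0)"
  by (auto simp: times_chosen_def)

text \<open>The strategy picks any reply that preserves \<open>Inv\<close>, so \<open>Inv\<close>
  holds along every play. This reduces a winning strategy to an invariant of histories.\<close>

lemma paintableI:
  assumes "Inv []"
    and "\<And>h. Inv h \<Longrightarrow> \<not> lister_won G b k h"
    and step: "\<And>h P. Inv h \<Longrightarrow> lister_move G b h P \<Longrightarrow> \<exists>X. painter_move G P X \<and> Inv (h @ [(P, X)])"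
  shows "paintable G b k"
proof -
  define s where "s h P = (SOME X. painter_move G P X \<and> Inv (h @ [(P, X)]))" for h P
  have s: "painter_move G P (s h P) \<and> Inv (h @ [(P, s h P)])"
    if "Inv h" "lister_move G b h P" for h P
    unfolding s_def by (rule someI_ex) (rule step[OF that])
  have "Inv h" if "play_with G b k s h" for h
    using that by induction (use assms(1) s in auto)
  with assms(2) s show ?thesis
    unfolding paintable_def painter_winning_strategy_def by blast
qed

text \<open>Painter always answers with a single vertex, so there are at most
  \<open>card (pverts G)\<close> rounds and no vertex is presented more often. \<open>Suc\<close>
  also keeps the bound positive for the empty graph.\<close>

lemma paintable_Suc_card:
  assumes "pair_graph G"
  shows "paintable G 1 (Suc (card (pverts G)))"
proof (rule paintableI)
  interpret pair_graph G by (rule assms)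
  let ?Inv = "\<lambda>h. length h = (\<Sum>v\<in>pverts G. times_chosen h v) \<and> (\<forall>v\<in>pverts G. times_chosen h v \<le> 1)"
  show "?Inv []" by simp
  show "\<not> lister_won G 1 (Suc (card (pverts G))) h" if "?Inv h" for h
  proof -
    have "length h \<le> card (pverts G)"
      using that sum_mono[of "pverts G" "times_chosen h" "\<lambda>_. 1"] by simp
    moreover have "times_presented h v \<le> length h" for v
      unfolding times_presented_def by simp
    ultimately show ?thesis
      unfolding lister_won_def by (metis Suc_n_not_le_n order_trans)
  qed
  show "\<exists>X. painter_move G P X \<and> ?Inv (h @ [(P, X)])"
    if inv: "?Inv h" and P: "lister_move G 1 h P" for h P
  proof -
    obtain v where v: "v \<in> P" "v \<in> pverts G" "times_chosen h v = 0"
      using P by (auto simp: lister_move_def)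
    moreover have "(v, v) \<notin> parcs G"
      using pair_no_loops by fastforce
    ultimately show ?thesis
      using inv
      by (intro exI[of _ "{v}"]) (auto simp: painter_move_def independent_in_def sum.distrib)
  qed
qed

lemma paint_number_paintable:
  assumes "pair_graph G"
  shows "0 < paint_number G \<and> paintable G 1 (paint_number G)"
  unfolding paint_number_def fold_paint_number_def
  by (rule LeastI[of _ "Suc (card (pverts G))"]) (use paintable_Suc_card[OF assms] in simp)

section \<open>Greedy selection of copies\<close>

lemma exists_maximizer:
  fixes w :: "'a \<Rightarrow> real"
  assumes "finite S" "S \<noteq> {}"
  obtains m where "m \<in> S" "\<And>v. v \<in> S \<Longrightarrow> w v \<le> w m"
proof -
  have "Max (w ` S) \<in> w ` S"
    using assms by (intro Max_in) auto
  then obtain m where "m \<in> S" "w m = Max (w ` S)" by auto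
  then show ?thesis
    using assms(1) by (intro that[of m]) simp_all
qed

text \<open>Select a heaviest vertex \<open>m\<close>, delete it and its neighbours, and recurse.
  Every vertex deleted as a neighbour of \<open>m\<close> weighs at most \<open>w m\<close>.\<close>

lemma exists_greedy_independent:
  fixes w :: "'a \<Rightarrow> real"
  assumes "pair_graph G" "S \<subseteq> pverts G"
  shows "\<exists>I. I \<subseteq> S \<and> independent_in G I \<and> (\<forall>v\<in>S - I. \<exists>u\<in>I. (v, u) \<in> parcs G \<and> w v \<le> w u)"
proof -
  interpret pair_graph G by (rule assms(1))
  have "finite S" using assms(2) finite_subset pair_finite_verts by blast
  then show ?thesis
    using assms(2)
  proof (induction rule: finite_psubset_induct)
    case (psubset S)
    show ?case
    proof (cases "S = {}")
      case False
      obtain m where m: "m \<in> S" "\<And>v. v \<in> S \<Longrightarrow> w v \<le> w m"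
        using exists_maximizer[OF psubset.hyps False, of w] by blast
      let ?S = "S - {m} - {v. (v, m) \<in> parcs G}"
      obtain I where I: "I \<subseteq> ?S" "independent_in G I"
        "\<forall>v\<in>?S - I. \<exists>u\<in>I. (v, u) \<in> parcs G \<and> w v \<le> w u"
        using psubset.IH[of ?S] psubset.prems m(1) by blast
      have "(m, m) \<notin> parcs G"
        using pair_no_loops by fastforce
      moreover have "(m, v) \<notin> parcs G" if "(v, m) \<notin> parcs G" for v
        using that arcs_symmetric by metis
      ultimately have "independent_in G (insert m I)"
        using I m psubset.prems unfolding independent_in_def by blast
      with I m show ?thesis
        by (intro exI[of _ "insert m I"]) auto
    qed (auto simp: independent_in_def)
  qed
qed

lemma card_neighbours_le_max_degree:
  assumes "pair_graph G" "v \<in> pverts G"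
  shows "card {u. (v, u) \<in> parcs G} \<le> max_degree G"
proof -
  interpret pair_graph G by (rule assms(1))
  have "{u. (v, u) \<in> parcs G} = snd ` out_arcs (with_proj G) v"
    by (force simp: out_arcs_def)
  then have "card {u. (v, u) \<in> parcs G} \<le> out_degree (with_proj G) v"
    unfolding out_degree_def by (metis card_image_le finite_out_arcs)
  also have "\<dots> \<le> max_degree G"
    using assms(2) unfolding max_degree_def by (intro Max_ge) auto
  finally show ?thesis .
qed

text \<open>A round \<open>(P, I)\<close> consists of the presented set of pairs and the selected set of copies.\<close>

definition kept :: "(('a \<times> 'b) set \<times> 'a set) list \<Rightarrow> 'a \<Rightarrow> 'b \<Rightarrow> nat" where
  "kept r v x = length (filter (\<lambda>(P, I). (v, x) \<in> P \<and> v \<in> I) r)"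

definition dropped :: "(('a \<times> 'b) set \<times> 'a set) list \<Rightarrow> 'a \<Rightarrow> 'b \<Rightarrow> nat" where
  "dropped r v x = length (filter (\<lambda>(P, I). (v, x) \<in> P \<and> v \<notin> I) r)"

lemma kept_simps [simp]:
  "kept [] v x = 0"
  "kept (r @ [(P, I)]) v x = kept r v x + (if (v, x) \<in> P \<and> v \<in> I then 1 else 0)"
  by (auto simp: kept_def)

lemma dropped_simps [simp]:
  "dropped [] v x = 0"
  "dropped (r @ [(P, I)]) v x = dropped r v x + (if (v, x) \<in> P \<and> v \<notin> I then 1 else 0)"
  by (auto simp: dropped_def)

section \<open>Weights and the charging argument\<close>

definition weight :: "real \<Rightarrow> (('a \<times> 'b) set \<times> 'a set) list \<Rightarrow> 'a \<Rightarrow> 'b \<Rightarrow> real" where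
  "weight e r v x = (1 + e) ^ dropped r v x * (1 / 2) ^ kept r v x"

text \<open>The set \<open>A\<close> is a parameter because both a whole copy of \<open>H\<close>
  and its part presented in a round are weighed.\<close>

definition total_weight ::
    "real \<Rightarrow> (('a \<times> 'b) set \<times> 'a set) list \<Rightarrow> 'b set \<Rightarrow> 'a \<Rightarrow> real" where
  "total_weight e r A v = (\<Sum>x\<in>A. weight e r v x)"

lemma weight_nonneg: "0 \<le> e \<Longrightarrow> 0 \<le> weight e r v x"
  by (simp add: weight_def)

lemma total_weight_nonneg: "0 \<le> e \<Longrightarrow> 0 \<le> total_weight e r A v"
  unfolding total_weight_def by (intro sum_nonneg weight_nonneg)

text \<open>Records only what the weight bound needs, so that one analysis serves list colouring and
  the painting game. Weights are compared as they stand before the round.\<close>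

inductive greedy_run ::
    "'a pair_pre_digraph \<Rightarrow> 'b set \<Rightarrow> real \<Rightarrow> (('a \<times> 'b) set \<times> 'a set) list \<Rightarrow> bool"
  for G W e where
  Nil: "greedy_run G W e []"
| snoc: "greedy_run G W e r \<Longrightarrow> P \<subseteq> pverts G \<times> W \<Longrightarrow> I \<subseteq> fst ` P \<Longrightarrow> independent_in G I \<Longrightarrow>
    (\<And>v. v \<in> fst ` P \<Longrightarrow> v \<notin> I \<Longrightarrow>
      \<exists>u\<in>I. (v, u) \<in> parcs G \<and> total_weight e r (P `` {v}) v \<le> total_weight e r (P `` {u}) u) \<Longrightarrow>
    greedy_run G W e (r @ [(P, I)])"

lemma greedy_run_extend:
  assumes "pair_graph G" "greedy_run G W e r" "P \<subseteq> pverts G \<times> W"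
  shows "\<exists>I. I \<subseteq> fst ` P \<and> independent_in G I \<and> greedy_run G W e (r @ [(P, I)])"
proof -
  have "fst ` P \<subseteq> pverts G"
    using image_mono[OF assms(3), of fst] by (auto simp: fst_image_times split: if_splits)
  from exists_greedy_independent[OF assms(1) this, of "\<lambda>v. total_weight e r (P `` {v}) v"]
  obtain I where I: "I \<subseteq> fst ` P" "independent_in G I"
    "\<forall>v\<in>fst ` P - I. \<exists>u\<in>I. (v, u) \<in> parcs G \<and>
      total_weight e r (P `` {v}) v \<le> total_weight e r (P `` {u}) u"
    by (elim exE conjE)
  have "greedy_run G W e (r @ [(P, I)])"
    using assms(2,3) I(1,2)
  proof (rule greedy_run.snoc)
    fix v assume "v \<in> fst ` P" "v \<notin> I"
    then show "\<exists>u\<in>I. (v, u) \<in> parcs G \<and>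
        total_weight e r (P `` {v}) v \<le> total_weight e r (P `` {u}) u"
      by (intro bspec[OF I(3)] DiffI)
  qed
  with I(1,2) show ?thesis
    by (intro exI[of _ I] conjI)
qed

lemma total_weight_snoc:
  assumes "finite W" "P \<subseteq> V \<times> W"
  shows "total_weight e (r @ [(P, I)]) W v =
    total_weight e r W v + (if v \<in> I then - 1 / 2 else e) * total_weight e r (P `` {v}) v"
proof -
  let ?d = "if v \<in> I then - 1 / 2 else e"
  have W: "W \<inter> {x. (v, x) \<in> P} = P `` {v}" using assms(2) by auto
  have "weight e (r @ [(P, I)]) v x =
      weight e r v x + (if x \<in> {x. (v, x) \<in> P} then ?d * weight e r v x else 0)" for x
    by (simp add: weight_def algebra_simps)
  then have "total_weight e (r @ [(P, I)]) W v =
      total_weight e r W v + (\<Sum>x\<in>W. if x \<in> {x. (v, x) \<in> P} then ?d * weight e r v x else 0)"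
    unfolding total_weight_def sum.distrib[symmetric] by (intro sum.cong refl)
  also have "(\<Sum>x\<in>W. if x \<in> {x. (v, x) \<in> P} then ?d * weight e r v x else 0) =
      ?d * total_weight e r (P `` {v}) v"
    unfolding total_weight_def by (simp only: sum.inter_restrict[OF assms(1), symmetric] W sum_distrib_left)
  finally show ?thesis .
qed

text \<open>\<open>A v\<close> is the total gain of the copy at \<open>v\<close>, i.e. the weight presented when it was selected.\<close>

lemma greedy_run_charging:
  fixes e :: real
  assumes "pair_graph G" "finite W" "0 \<le> e" "greedy_run G W e r"
  shows "\<exists>A. (\<forall>v. 0 \<le> A v) \<and>
    (\<forall>v. total_weight e r W v \<le> card W - A v / 2 + e * (\<Sum>u | (v, u) \<in> parcs G. A u))"
  using assms(4)
proof induction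
  case Nil
  show ?case
    by (intro exI[of _ "\<lambda>_. 0"]) (simp add: total_weight_def weight_def)
next
  case (snoc r P I)
  interpret pair_graph G by (rule assms(1))
  have fin: "finite {u. (v, u) \<in> parcs G}" for v
    by (rule finite_subset[of _ "pverts G"]) (use in_arcsD2 in fastforce)+
  obtain A where A: "\<And>v. 0 \<le> A v"
    "\<And>v. total_weight e r W v \<le> card W - A v / 2 + e * (\<Sum>u | (v, u) \<in> parcs G. A u)"
    using snoc.IH by blast
  let ?w = "\<lambda>v. total_weight e r (P `` {v}) v"
  \<comment> \<open>The gain of a selected copy is its presented weight; half of it is what the copy
    loses in this round, matching the term \<open>A' v / 2\<close>.\<close>
  define A' where "A' v = A v + (if v \<in> I then ?w v else 0)" for v
  have w: "0 \<le> ?w v" for v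
    by (rule total_weight_nonneg[OF assms(3)])
  have A_le: "A v \<le> A' v" for v
    using w by (simp add: A'_def)
  have "total_weight e (r @ [(P, I)]) W v \<le> card W - A' v / 2 + e * (\<Sum>u | (v, u) \<in> parcs G. A' u)" for v
  proof (cases "v \<in> I")
    case True
    have "e * (\<Sum>u | (v, u) \<in> parcs G. A u) \<le> e * (\<Sum>u | (v, u) \<in> parcs G. A' u)"
      by (intro mult_left_mono sum_mono A_le assms(3))
    moreover have "total_weight e (r @ [(P, I)]) W v = total_weight e r W v - ?w v / 2"
      using True by (simp add: total_weight_snoc[OF assms(2) snoc.hyps(2)])
    moreover have "A' v = A v + ?w v"
      using True by (simp add: A'_def)
    ultimately show ?thesis
      using A(2)[of v] by linarith
  next
    case False
    \<comment> \<open>A skipped copy grows by \<open>e * ?w v\<close>. This is paid by one selected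
      neighbour, whose gain in this round is at least \<open>?w v\<close>; a copy that is not
      presented has nothing to pay.\<close>
    have "(\<Sum>u | (v, u) \<in> parcs G. A u) + ?w v \<le> (\<Sum>u | (v, u) \<in> parcs G. A' u)"
    proof (cases "v \<in> fst ` P")
      case True
      with snoc.hyps False obtain u where u: "u \<in> I" "(v, u) \<in> parcs G" "?w v \<le> ?w u"
        by blast
      have "?w u = (\<Sum>t\<in>{u}. if t \<in> I then ?w t else 0)"
        using u by simp
      also have "\<dots> \<le> (\<Sum>t | (v, t) \<in> parcs G. if t \<in> I then ?w t else 0)"
        using u w by (intro sum_mono2 fin) auto
      finally show ?thesis
        using u(3) by (simp add: A'_def sum.distrib)
    next
      case False
      then have "P `` {v} = {}" by force
      then have "?w v = 0" by (simp add: total_weight_def)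
      then show ?thesis by (simp add: sum_mono A_le)
    qed
    from mult_left_mono[OF this assms(3)]
    have "e * (\<Sum>u | (v, u) \<in> parcs G. A u) + e * ?w v \<le> e * (\<Sum>u | (v, u) \<in> parcs G. A' u)"
      by (simp only: distrib_left)
    moreover have "total_weight e (r @ [(P, I)]) W v = total_weight e r W v + e * ?w v"
      using False by (simp add: total_weight_snoc[OF assms(2) snoc.hyps(2)])
    moreover have "A' v = A v"
      using False by (simp add: A'_def)
    ultimately show ?thesis
      using A(2)[of v] by linarith
  qed
  moreover have "0 \<le> A' v" for v
    using A(1) A_le by (rule order_trans)
  ultimately show ?case by blast
qed

text \<open>Let \<open>m\<close> have the largest gain. Neighbours contribute at most
  \<open>A m / 4\<close> to any copy, so nonnegativity of the total weight at \<open>m\<close> gives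
  \<open>A m \<le> 4 * card W\<close>. Hence every copy weighs at most
  \<open>card W + A m / 4 \<le> 2 * card W\<close>.\<close>

lemma greedy_run_weight_le:
  fixes e :: real
  assumes "pair_graph G" "finite W" "0 \<le> e" "4 * max_degree G * e \<le> 1" "greedy_run G W e r"
    and "v \<in> pverts G" "x \<in> W"
  shows "weight e r v x \<le> 2 * card W"
proof -
  interpret pair_graph G by (rule assms(1))
  obtain A where A: "\<And>v. 0 \<le> A v"
    "\<And>v. total_weight e r W v \<le> card W - A v / 2 + e * (\<Sum>u | (v, u) \<in> parcs G. A u)"
    using greedy_run_charging[OF assms(1,2,3,5)] by blast
  obtain m where m: "m \<in> pverts G" "\<And>u. u \<in> pverts G \<Longrightarrow> A u \<le> A m"
    using exists_maximizer[of "pverts G" A] assms(6) by auto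
  have nb: "e * (\<Sum>u | (z, u) \<in> parcs G. A u) \<le> A m / 4" if "z \<in> pverts G" for z
  proof -
    have "(\<Sum>u | (z, u) \<in> parcs G. A u) \<le> real (card {u. (z, u) \<in> parcs G}) * A m"
      using m(2) in_arcsD2 by (intro sum_bounded_above) fastforce
    also have "\<dots> \<le> max_degree G * A m"
      using card_neighbours_le_max_degree[OF assms(1) that] A(1) by (intro mult_right_mono) auto
    finally have "e * (\<Sum>u | (z, u) \<in> parcs G. A u) \<le> e * (max_degree G * A m)"
      using assms(3) by (rule mult_left_mono)
    also have "\<dots> = (4 * max_degree G * e) * A m / 4" by simp
    also have "\<dots> \<le> A m / 4"
      using mult_right_mono[OF assms(4) A(1)[of m]] by simp
    finally show ?thesis .
  qed
  have "A m \<le> 4 * card W"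
    using A(2)[of m] nb[OF m(1)] total_weight_nonneg[OF assms(3), of r W m] by simp
  then have "total_weight e r W v \<le> 2 * card W"
    using A(2)[of v] A(1)[of v] nb[OF assms(6)] by simp
  moreover have "weight e r v x \<le> total_weight e r W v"
    unfolding total_weight_def using assms by (intro member_le_sum weight_nonneg) auto
  ultimately show ?thesis by simp
qed

section \<open>From the weight bound to the number of kept rounds\<close>

lemma many_kept:
  fixes d k n :: nat
  defines "K \<equiv> nat \<lfloor>(4 * real d + 2) * (real k + log 2 (real n))\<rfloor>"
  assumes "0 < n" "kept r v x + dropped r v x = K" "weight (1 / (4 * real d + 1)) r v x \<le> 2 * n"
  shows "k \<le> kept r v x"
proof (rule ccontr)
  assume "\<not> k \<le> kept r v x"
  then have less: "real (kept r v x) + 1 \<le> real k" by linarith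
  define m where "m = 4 * d + 1"
  define c where "c = 1 + 1 / real m"
  have m: "real m = 4 * real d + 1" "0 < real m" by (simp_all add: m_def)
  have c: "1 < c" using m by (simp add: c_def)
  \<comment> \<open>Bernoulli's inequality for \<open>c = 1 + 1 / m\<close>; thus
    \<open>log 2 c\<close> is at least \<open>1 / m\<close>, which turns the weight bound into a
    linear bound on \<open>dropped\<close>.\<close>
  have "2 \<le> c ^ m"
    using Bernoulli_inequality[of "1 / real m" m] m(2)
    by (simp add: c_def order_trans[of "- 1" 0])
  then have "log 2 2 \<le> log 2 (c ^ m)"
    using c by (intro log_mono) auto
  then have log_c: "1 \<le> real m * log 2 c"
    using c by (simp add: log_nat_power)
  have L: "0 \<le> log 2 (real n)" using assms(2) by simp
  have weight: "weight (1 / (4 * real d + 1)) r v x = c ^ dropped r v x * (1 / 2) ^ kept r v x"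
    by (simp add: weight_def c_def m)
  have "0 < weight (1 / (4 * real d + 1)) r v x"
    unfolding weight using c by simp
  with assms(4) have "log 2 (weight (1 / (4 * real d + 1)) r v x) \<le> log 2 (2 * n)"
    by (intro log_mono) auto
  moreover have "log 2 (weight (1 / (4 * real d + 1)) r v x) = dropped r v x * log 2 c - kept r v x"
    unfolding weight using c by (simp add: log_mult log_nat_power log_divide power_one_over)
  moreover have "log 2 (2 * n) = 1 + log 2 n"
    using assms(2) by (simp add: log_mult)
  ultimately have "dropped r v x * log 2 c \<le> k + log 2 n"
    using less by simp
  then have "m * (dropped r v x * log 2 c) \<le> m * (k + log 2 n)"
    by (intro mult_left_mono) auto
  moreover have "real (dropped r v x) \<le> m * (dropped r v x * log 2 c)"
    using mult_left_mono[OF log_c, of "real (dropped r v x)"] by (simp only: mult.left_commute) simp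
  ultimately have "dropped r v x \<le> (4 * real d + 1) * (k + log 2 n)"
    unfolding m(1)[symmetric] by linarith
  \<comment> \<open>The spare \<open>1\<close> comes from \<open>kept < k\<close> over the integers;
    it makes the sum smaller than \<open>K\<close> despite the floor.\<close>
  then have "kept r v x + dropped r v x + 1 \<le> (4 * real d + 2) * (k + log 2 n)"
    using less L by (simp add: algebra_simps)
  then show False
    using assms(3) unfolding K_def by linarith
qed

section \<open>The lexicographic product\<close>

text \<open>The rounds are the colours in an arbitrary order; a colour presents the pairs whose
  lists contain it. Each pair keeps at least \<open>k\<close> colours, so every copy of
  \<open>H\<close> can be coloured separately from its kept colours.\<close>

lemma choosable_lex_product:
  assumes "pair_graph G" "pair_graph H" "choosable H k"
  shows "choosable (lex_product G H)
    (nat \<lfloor>(4 * real (max_degree G) + 2) * (real k + log 2 (real (card (pverts H))))\<rfloor>)"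
    (is "choosable _ ?K")
  unfolding choosable_def
proof (intro allI impI)
  interpret G: pair_graph G by (rule assms(1))
  interpret H: pair_graph H by (rule assms(2))
  fix L :: "'a \<times> 'b \<Rightarrow> nat set"
  assume "\<forall>p\<in>pverts (lex_product G H). finite (L p) \<and> card (L p) = ?K"
  then have L: "finite (L (v, x))" "card (L (v, x)) = ?K" if "v \<in> pverts G" "x \<in> pverts H" for v x
    using that by (auto simp: lex_product_def)
  define e where "e = 1 / (4 * real (max_degree G) + 1)"
  have e: "0 \<le> e" "4 * max_degree G * e \<le> 1" by (simp_all add: e_def)
  define C where "C = (\<Union>p\<in>pverts G \<times> pverts H. L p)"
  have "finite C" using L by (auto simp: C_def)
  then obtain cs where cs: "distinct cs" "set cs = C"
    using finite_distinct_list by blast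
  define P where "P c = {p \<in> pverts G \<times> pverts H. c \<in> L p}" for c
  have "\<exists>I. greedy_run G (pverts H) e (map (\<lambda>c. (P c, I c)) ds) \<and> (\<forall>c\<in>set ds. independent_in G (I c))"
    if "distinct ds" for ds
    using that
  proof (induction ds rule: rev_induct)
    case Nil
    show ?case by (simp add: greedy_run.Nil)
  next
    case (snoc d ds)
    then obtain I where I: "greedy_run G (pverts H) e (map (\<lambda>c. (P c, I c)) ds)"
      "\<forall>c\<in>set ds. independent_in G (I c)" by auto
    have "P d \<subseteq> pverts G \<times> pverts H" by (auto simp: P_def)
    from greedy_run_extend[OF assms(1) I(1) this]
    obtain J where J: "independent_in G J"
      "greedy_run G (pverts H) e (map (\<lambda>c. (P c, I c)) ds @ [(P d, J)])" by blast
    \<comment> \<open>Since the colours are distinct, setting the value at \<open>d\<close> leaves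
      the earlier rounds unchanged.\<close>
    have "map (\<lambda>c. (P c, (I(d := J)) c)) ds = map (\<lambda>c. (P c, I c)) ds"
      using snoc.prems by auto
    then have "map (\<lambda>c. (P c, (I(d := J)) c)) (ds @ [d]) = map (\<lambda>c. (P c, I c)) ds @ [(P d, J)]"
      by simp
    moreover have "\<forall>c\<in>set (ds @ [d]). independent_in G ((I(d := J)) c)"
      using J I(2) by simp
    ultimately show ?case
      using J(2) by metis
  qed
  from this[OF cs(1)] obtain I where
    run: "greedy_run G (pverts H) e (map (\<lambda>c. (P c, I c)) cs)" and
    ind: "\<And>c. c \<in> C \<Longrightarrow> independent_in G (I c)"
    using cs(2) by auto
  define M where "M v x = {c \<in> L (v, x). v \<in> I c}" for v x
  have M: "finite (M v x) \<and> k \<le> card (M v x)" if vx: "v \<in> pverts G" "x \<in> pverts H" for v x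
  proof
    let ?r = "map (\<lambda>c. (P c, I c)) cs"
    have kept: "kept ?r v x = card (M v x)"
    proof -
      have "M v x = {c. (v, x) \<in> P c \<and> v \<in> I c} \<inter> set cs"
        using vx by (auto simp: M_def P_def C_def cs(2))
      then show ?thesis
        by (simp add: kept_def filter_map comp_def distinct_length_filter[OF cs(1)])
    qed
    have dropped: "dropped ?r v x = card (L (v, x) - M v x)"
    proof -
      have "L (v, x) - M v x = {c. (v, x) \<in> P c \<and> v \<notin> I c} \<inter> set cs"
        using vx by (auto simp: M_def P_def C_def cs(2))
      then show ?thesis
        by (simp add: dropped_def filter_map comp_def distinct_length_filter[OF cs(1)])
    qed
    have sub: "M v x \<subseteq> L (v, x)" by (auto simp: M_def)
    then show "finite (M v x)" using L(1)[OF vx] finite_subset by blast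
    with sub L[OF vx] have "kept ?r v x + dropped ?r v x = ?K"
      unfolding kept dropped by (metis card_Diff_subset card_mono le_add_diff_inverse)
    moreover have "weight e ?r v x \<le> 2 * card (pverts H)"
      using greedy_run_weight_le[OF assms(1) _ e run vx] by simp
    moreover have "0 < card (pverts H)"
      using vx by (auto simp: card_gt_0_iff)
    ultimately have "k \<le> kept ?r v x"
      unfolding e_def by (intro many_kept) auto
    then show "k \<le> card (M v x)" by (simp only: kept)
  qed
  have "\<forall>v\<in>pverts G. list_colorable H (M v)"
    using M by (intro ballI list_colorable_if_choosable[OF assms(3)])
  then have "\<forall>v\<in>pverts G. \<exists>c. (\<forall>x\<in>pverts H. c x \<in> M v x) \<and> (\<forall>(x, y)\<in>parcs H. c x \<noteq> c y)"
    by (simp only: list_colorable_def)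
  from bchoice[OF this] obtain f where f: "\<And>v x. v \<in> pverts G \<Longrightarrow> x \<in> pverts H \<Longrightarrow> f v x \<in> M v x"
    "\<And>v x y. v \<in> pverts G \<Longrightarrow> (x, y) \<in> parcs H \<Longrightarrow> f v x \<noteq> f v y"
    by fast
  have "f u x \<noteq> f v y" if "((u, x), (v, y)) \<in> parcs (lex_product G H)" for u x v y
  proof
    assume eq: "f u x = f v y"
    have uv: "u \<in> pverts G" "x \<in> pverts H" "v \<in> pverts G" "y \<in> pverts H"
      and "(u, v) \<in> parcs G \<or> u = v \<and> (x, y) \<in> parcs H"
      using that by (auto simp: lex_product_def)
    with f(2) eq have arc: "(u, v) \<in> parcs G" by auto
    \<comment> \<open>A colour shared by two copies was kept by both, so \<open>u\<close> and
      \<open>v\<close> lie in the same independent set.\<close>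
    have "f u x \<in> M u x" "f u x \<in> M v y"
      using f(1)[of u x] f(1)[of v y] uv eq by auto
    then have "u \<in> I (f u x)" "v \<in> I (f u x)" "f u x \<in> C"
      using uv by (auto simp: M_def C_def)
    with ind arc show False
      unfolding independent_in_def by blast
  qed
  with f(1) show "list_colorable (lex_product G H) L"
    unfolding list_colorable_def
    by (intro exI[of _ "case_prod f"]) (fastforce simp: lex_product_def M_def)
qed

section \<open>The painting game on the product\<close>

text \<open>Painter runs a private game with strategy \<open>s\<close> on each copy of
  \<open>H\<close> and advances it only when the copy is selected. After \<open>?K\<close>
  presentations of a pair its private game has presented it at least \<open>k\<close> times, so
  \<open>s\<close> has already chosen it.\<close>

lemma paintable_lex_product:
  assumes "pair_graph G" "pair_graph H" "paintable H 1 k"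
  shows "paintable (lex_product G H) 1
    (nat \<lfloor>(4 * real (max_degree G) + 2) * (real k + log 2 (real (card (pverts H))))\<rfloor>)"
    (is "paintable ?GH 1 ?K")
proof -
  interpret G: pair_graph G by (rule assms(1))
  interpret H: pair_graph H by (rule assms(2))
  obtain s where s: "painter_winning_strategy H 1 k s"
    using assms(3) by (auto simp: paintable_def)
  define e where "e = 1 / (4 * real (max_degree G) + 1)"
  have e: "0 \<le> e" "4 * max_degree G * e \<le> 1" by (simp_all add: e_def)
  \<comment> \<open>\<open>g v\<close> is the play on the copy of \<open>H\<close> at \<open>v\<close>, which consists of the rounds selecting \<open>v\<close>.\<close>
  define Inv where "Inv h \<longleftrightarrow> (\<exists>r g. greedy_run G (pverts H) e r \<and>
    (\<forall>v\<in>pverts G. play_with H 1 k s (g v)) \<and>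
    (\<forall>v\<in>pverts G. \<forall>x\<in>pverts H.
      times_presented (g v) x = kept r v x \<and>
      times_presented h (v, x) = kept r v x + dropped r v x \<and>
      times_chosen (g v) x = times_chosen h (v, x)))" for h :: "('a \<times> 'b) history"
  show ?thesis
  proof (rule paintableI[where Inv = Inv])
    show "Inv []"
      unfolding Inv_def
      by (intro exI[of _ "[]"] exI[of _ "\<lambda>_. []"]) (simp add: greedy_run.Nil play_with.start)
  next
    fix h assume "Inv h"
    then obtain r g where run: "greedy_run G (pverts H) e r" and
      g: "\<And>v. v \<in> pverts G \<Longrightarrow> play_with H 1 k s (g v)" and
      cnt: "\<And>v x. v \<in> pverts G \<Longrightarrow> x \<in> pverts H \<Longrightarrow>
        times_presented (g v) x = kept r v x \<and>
        times_presented h (v, x) = kept r v x + dropped r v x \<and>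
        times_chosen (g v) x = times_chosen h (v, x)"
      unfolding Inv_def by blast
    show "\<not> lister_won ?GH 1 ?K h"
    proof
      assume "lister_won ?GH 1 ?K h"
      then obtain v x where vx: "v \<in> pverts G" "x \<in> pverts H" and
        lost: "times_presented h (v, x) = ?K" "times_chosen h (v, x) < 1"
        by (auto simp: lister_won_def lex_product_def)
      have "\<not> lister_won H 1 k (g v)"
        using s g[OF vx(1)] unfolding painter_winning_strategy_def by blast
      then have "times_presented (g v) x \<noteq> k"
        using vx cnt[OF vx] lost(2) unfolding lister_won_def by auto
      \<comment> \<open>\<open>lister_won\<close> tests for exactly \<open>k\<close> presentations;
        more than \<open>k\<close> cannot occur because play stops once Lister has won.\<close>
      then have "kept r v x < k"
        using play_with_presented_le[OF g[OF vx(1)] vx(2)] cnt[OF vx] by auto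
      moreover have "weight e r v x \<le> 2 * card (pverts H)"
        using greedy_run_weight_le[OF assms(1) _ e run vx] by simp
      moreover have "0 < card (pverts H)"
        using vx by (auto simp: card_gt_0_iff)
      ultimately show False
        using many_kept[of "card (pverts H)" r v x "max_degree G" k] cnt[OF vx] lost(1)
        unfolding e_def by auto
    qed
    fix P assume P: "lister_move ?GH 1 h P"
    then have P_sub: "P \<subseteq> pverts G \<times> pverts H" by (simp add: lister_move_def lex_product_def)
    obtain I where I: "I \<subseteq> fst ` P" "independent_in G I" "greedy_run G (pverts H) e (r @ [(P, I)])"
      using greedy_run_extend[OF assms(1) run P_sub] by blast
    define Y where "Y v = s (g v) (P `` {v})" for v
    \<comment> \<open>The union of the private replies is independent: distinct selected copies are
      not adjacent, and each reply is independent within its copy.\<close>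
    define X where "X = Sigma I Y"
    have I_sub: "I \<subseteq> pverts G" using I(2) by (simp add: independent_in_def)
    have move: "lister_move H 1 (g v) (P `` {v})" if "v \<in> I" for v
      unfolding lister_move_def
    proof (intro conjI ballI)
      show "P `` {v} \<noteq> {}" using that I(1) by fastforce
      show "P `` {v} \<subseteq> pverts H" using P_sub by auto
      fix x assume "x \<in> P `` {v}"
      moreover from this have "v \<in> pverts G" "x \<in> pverts H" using P_sub by auto
      ultimately show "times_chosen (g v) x < 1"
        using P cnt by (auto simp: lister_move_def)
    qed
    have Y: "Y v \<subseteq> P `` {v}" "independent_in H (Y v)" if "v \<in> I" for v
      using s g[of v] move[OF that] that I_sub
      unfolding painter_winning_strategy_def painter_move_def Y_def by blast+
    have "painter_move ?GH P X"
      unfolding painter_move_def independent_in_def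
    proof (intro conjI ballI)
      show "X \<subseteq> P" using Y(1) by (auto simp: X_def)
      then show "X \<subseteq> pverts ?GH" using P_sub by (auto simp: lex_product_def)
      fix p q assume "p \<in> X" "q \<in> X"
      then show "(p, q) \<notin> parcs ?GH"
        using I(2) Y(2) unfolding X_def independent_in_def lex_product_def by auto
    qed
    moreover have "Inv (h @ [(P, X)])"
      unfolding Inv_def
    proof (intro exI conjI ballI)
      let ?g = "\<lambda>v. if v \<in> I then g v @ [(P `` {v}, Y v)] else g v"
      show "greedy_run G (pverts H) e (r @ [(P, I)])" by (rule I(3))
      show "play_with H 1 k s (?g v)" if "v \<in> pverts G" for v
        using g[OF that] move s
        unfolding painter_winning_strategy_def Y_def by (auto intro: play_with.round)
      fix v x assume vx: "v \<in> pverts G" "x \<in> pverts H"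
      show "times_presented (?g v) x = kept (r @ [(P, I)]) v x"
        "times_presented (h @ [(P, X)]) (v, x) = kept (r @ [(P, I)]) v x + dropped (r @ [(P, I)]) v x"
        "times_chosen (?g v) x = times_chosen (h @ [(P, X)]) (v, x)"
        using cnt[OF vx] by (auto simp: X_def)
    qed
    ultimately show "\<exists>X. painter_move ?GH P X \<and> Inv (h @ [(P, X)])" by blast
  qed
qed

theorem theorem1:
  fixes G :: "'a pair_pre_digraph" and H :: "'b pair_pre_digraph" and n :: nat
  assumes "pair_graph G" and "pair_graph H"
    and "card (pverts H) = n"
  shows "real (choice_number (lex_product G H))
           \<le> (4 * real (max_degree G) + 2) * (real (choice_number H) + log 2 (real n))
       \<and> real (paint_number (lex_product G H))
           \<le> (4 * real (max_degree G) + 2) * (real (paint_number H) + log 2 (real n))"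
proof -
  let ?b = "\<lambda>k. (4 * real (max_degree G) + 2) * (real k + log 2 (real n))"
  \<comment> \<open>For \<open>n = 0\<close> this relies on \<open>log 2 0 = 0\<close>.\<close>
  have L: "0 \<le> log 2 (real n)"
    by (cases "n = 0") (simp_all add: log_def)
  then have b: "2 * real k \<le> ?b k" for k
    by (intro mult_mono) auto
  have "choice_number (lex_product G H) \<le> nat \<lfloor>?b (choice_number H)\<rfloor>"
    unfolding choice_number_def[of "lex_product G H"]
    using choosable_lex_product[OF assms(1,2) choosable_choice_number[OF assms(2)]]
    by (intro Least_le) (simp add: assms(3))
  moreover have "paint_number (lex_product G H) \<le> nat \<lfloor>?b (paint_number H)\<rfloor>"
  proof -
    have k: "0 < paint_number H" "paintable H 1 (paint_number H)"
      using paint_number_paintable[OF assms(2)] by auto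
    \<comment> \<open>The minimum in \<open>fold_paint_number\<close> ranges over positive values
      only, so the bound itself has to be positive.\<close>
    have "0 < nat \<lfloor>?b (paint_number H)\<rfloor>"
      using k(1) b[of "paint_number H"] by linarith
    then show ?thesis
      unfolding paint_number_def[of "lex_product G H"] fold_paint_number_def
      using paintable_lex_product[OF assms(1,2) k(2)]
      by (intro Least_le) (simp add: assms(3))
  qed
  moreover have "real (nat \<lfloor>?b k\<rfloor>) \<le> ?b k" for k
    using b[of k] by linarith
  ultimately show ?thesis
    by (meson of_nat_le_iff order_trans)
qed

end
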